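(* Let $2\le p<\infty$ and let $(\mu_j)_{j\ge1}$ be a sequence of positive numbers. Suppose that there exists a constant $C_p>0$ such that $$\left\|\Big(\sum_{j\ge1}|R_jf|^2\Big)^{1/2}\right\|_{L_p(\Omega_\infty,\nu_\infty)}\le C_p\|f\|_{L_p(\Omega_\infty,\nu_\infty)}$$ for every mean-zero function $f$ on $\Omega_\infty$ depending on only finitely many coordinates. Then $$M=\sup_{j\ge1}\max\{\mu_j,\mu_j^{-1}\}<\infty.$$
   Context: $\Omega_\infty=\{-1,1\}^{\mathbb N}$ carries the product probability measure $\nu_\infty=\bigotimes_{j\ge1}\nu_j$, where $\nu_j(\{-1\})=\frac{\mu_j^2}{\mu_j^{-2}+\mu_j^2}$ and $\nu_j(\{1\})=\frac{\mu_j^{-2}}{\mu_j^{-2}+\mu_j^2}$. Let $\zeta_j(\omega)=\mu_j^2$ if $\omega_j=1$ and $\zeta_j(\omega)=-\mu_j^{-2}$ if $\omega_j=-1$; for finite $A\subset\mathbb N$, $\zeta_\varnothing=1$, $\zeta_A=\prod_{j\in A}\zeta_j$. The $\zeta_A$ are orthonormal in $L_2(\nu_\infty)$ and span the functions depending on finitely many coordinates. Linear operators on such functions: $D_j(\zeta_A)=\zeta_{A\setminus\{j\}}$ if $j\in A$ and $0$ otherwise; $N\zeta_A=|A|\zeta_A$; $N^{-1/2}\zeta_A=|A|^{-1/2}\zeta_A$ for $A\ne\varnothing$; and $R_j=\frac{\mu_j^{-2}+\mu_j^2}{2}D_jN^{-1/2}$ on mean-zero functions depending on finitely many coordinates (mean-zero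 means $\int f\,d\nu_\infty=0$). *)

theory Defs
  imports "HOL-Probability.Probability"
begin

text \<open>The space \<open>{-1,1}\<^sup>\<nat>\<close> is the type \<open>nat \<Rightarrow> bool\<close>, with \<open>True\<close> for \<open>1\<close>
  and \<open>False\<close> for \<open>-1\<close>; the index set \<open>{1,2,\<dots>}\<close> is shifted to the type \<open>nat\<close>.
  Functions take values in a complete field \<open>'a\<close> with multiplicative norm, that is, in the
  real or the complex numbers.\<close>

definition nu :: "(nat \<Rightarrow> real) \<Rightarrow> nat \<Rightarrow> bool measure" where
  "nu \<mu> j = measure_pmf (bernoulli_pmf
      (inverse ((\<mu> j)\<^sup>2) / (inverse ((\<mu> j)\<^sup>2) + (\<mu> j)\<^sup>2)))"

definition nu_inf :: "(nat \<Rightarrow> real) \<Rightarrow> (nat \<Rightarrow> bool) measure" where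
  "nu_inf \<mu> = PiM UNIV (nu \<mu>)"

definition zeta1 :: "(nat \<Rightarrow> real) \<Rightarrow> nat \<Rightarrow> (nat \<Rightarrow> bool) \<Rightarrow> real" where
  "zeta1 \<mu> j x = (if x j then (\<mu> j)\<^sup>2 else - inverse ((\<mu> j)\<^sup>2))"

definition zeta :: "(nat \<Rightarrow> real) \<Rightarrow> nat set \<Rightarrow> (nat \<Rightarrow> bool) \<Rightarrow> real" where
  "zeta \<mu> A x = (\<Prod>j\<in>A. zeta1 \<mu> j x)"

definition depends_on :: "((nat \<Rightarrow> bool) \<Rightarrow> 'b) \<Rightarrow> nat set \<Rightarrow> bool" where
  "depends_on f J \<longleftrightarrow> (\<forall>x x'. (\<forall>j\<in>J. x j = x' j) \<longrightarrow> f x = f x')"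

definition depends_on_finitely_many :: "((nat \<Rightarrow> bool) \<Rightarrow> 'b) \<Rightarrow> bool" where
  "depends_on_finitely_many f \<longleftrightarrow> (\<exists>J. finite J \<and> depends_on f J)"

definition mean_zero ::
  "(nat \<Rightarrow> real) \<Rightarrow> ((nat \<Rightarrow> bool) \<Rightarrow> 'a::{banach, second_countable_topology}) \<Rightarrow> bool" where
  "mean_zero \<mu> f \<longleftrightarrow> integral\<^sup>L (nu_inf \<mu>) f = 0"

text \<open>The \<open>\<zeta>\<^sub>A\<close>, for \<open>A\<close> finite, are a basis of the space of functions depending on finitely many
  coordinates; \<open>is_zeta_expansion \<mu> f c\<close> says that \<open>f = (\<Sum>A. c A \<zeta>\<^sub>A)\<close> is a finite sum.
  Existence and uniqueness of the coefficients are \<open>zeta_expansion_exists\<close> and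
  \<open>zeta_expansion_unique\<close> below.\<close>

definition is_zeta_expansion ::
  "(nat \<Rightarrow> real) \<Rightarrow> ((nat \<Rightarrow> bool) \<Rightarrow> 'a::real_normed_field) \<Rightarrow> (nat set \<Rightarrow> 'a) \<Rightarrow> bool" where
  "is_zeta_expansion \<mu> f c \<longleftrightarrow>
     finite {A. c A \<noteq> 0} \<and> (\<forall>A. c A \<noteq> 0 \<longrightarrow> finite A) \<and>
     (\<forall>x. f x = (\<Sum>A | c A \<noteq> 0. c A * of_real (zeta \<mu> A x)))"

definition zeta_coeff ::
  "(nat \<Rightarrow> real) \<Rightarrow> ((nat \<Rightarrow> bool) \<Rightarrow> 'a::real_normed_field) \<Rightarrow> nat set \<Rightarrow> 'a" where
  "zeta_coeff \<mu> f = (THE c. is_zeta_expansion \<mu> f c)"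

text \<open>The linear operator with \<open>\<zeta>\<^sub>A \<mapsto> T A\<close>.\<close>

definition zeta_linear ::
  "(nat \<Rightarrow> real) \<Rightarrow> (nat set \<Rightarrow> (nat \<Rightarrow> bool) \<Rightarrow> real) \<Rightarrow>
    ((nat \<Rightarrow> bool) \<Rightarrow> 'a::real_normed_field) \<Rightarrow> (nat \<Rightarrow> bool) \<Rightarrow> 'a" where
  "zeta_linear \<mu> T f x =
     (\<Sum>A | zeta_coeff \<mu> f A \<noteq> 0. zeta_coeff \<mu> f A * of_real (T A x))"

definition D_op ::
  "(nat \<Rightarrow> real) \<Rightarrow> nat \<Rightarrow> ((nat \<Rightarrow> bool) \<Rightarrow> 'a::real_normed_field) \<Rightarrow> (nat \<Rightarrow> bool) \<Rightarrow> 'a" where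
  "D_op \<mu> j = zeta_linear \<mu> (\<lambda>A x. if j \<in> A then zeta \<mu> (A - {j}) x else 0)"

text \<open>On \<open>\<zeta>\<close> of the empty set the following operator is \<open>0\<close>, since \<open>0 powr (-1/2) = 0\<close>;
  that value is irrelevant on mean-zero functions.\<close>

definition N_inv_sqrt ::
  "(nat \<Rightarrow> real) \<Rightarrow> ((nat \<Rightarrow> bool) \<Rightarrow> 'a::real_normed_field) \<Rightarrow> (nat \<Rightarrow> bool) \<Rightarrow> 'a" where
  "N_inv_sqrt \<mu> = zeta_linear \<mu> (\<lambda>A x. real (card A) powr (-1/2) * zeta \<mu> A x)"

definition R_op ::
  "(nat \<Rightarrow> real) \<Rightarrow> nat \<Rightarrow> ((nat \<Rightarrow> bool) \<Rightarrow> 'a::real_normed_field) \<Rightarrow> (nat \<Rightarrow> bool) \<Rightarrow> 'a" where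
  "R_op \<mu> j f x =
     of_real ((inverse ((\<mu> j)\<^sup>2) + (\<mu> j)\<^sup>2) / 2) * D_op \<mu> j (N_inv_sqrt \<mu> f) x"

text \<open>For a function depending on finitely many coordinates the integral below is that of an
  integrable function (\<open>integrable_finitely_many\<close>), and the series in \<open>square_fun\<close> has only
  finitely many nonzero terms (\<open>R_op_eq_0\<close>), so its value again depends on finitely many
  coordinates.\<close>

definition Lp_norm :: "real \<Rightarrow> 'b measure \<Rightarrow> ('b \<Rightarrow> 'a::real_normed_vector) \<Rightarrow> real" where
  "Lp_norm p M f = (\<integral>x. norm (f x) powr p \<partial>M) powr (1 / p)"

definition square_fun ::
  "(nat \<Rightarrow> real) \<Rightarrow> ((nat \<Rightarrow> bool) \<Rightarrow> 'a::real_normed_field) \<Rightarrow> (nat \<Rightarrow> bool) \<Rightarrow> real" where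
  "square_fun \<mu> f x = sqrt (\<Sum>j. (norm (R_op \<mu> j f x))\<^sup>2)"


lemma zeta1_upd [simp]:
  "zeta1 \<mu> j (x(j := True)) = (\<mu> j)\<^sup>2" "zeta1 \<mu> j (x(j := False)) = - inverse ((\<mu> j)\<^sup>2)"
  by (auto simp: zeta1_def)

lemma zeta_upd: "j \<notin> A \<Longrightarrow> zeta \<mu> A (x(j := b)) = zeta \<mu> A x"
  unfolding zeta_def zeta1_def by (intro prod.cong) auto

lemma zeta_insert:
  "finite A \<Longrightarrow> j \<notin> A \<Longrightarrow> zeta \<mu> (insert j A) x = zeta1 \<mu> j x * zeta \<mu> A x"
  unfolding zeta_def by simp

lemma sum_Pow_insert_split:
  fixes g :: "nat set \<Rightarrow> 'a::comm_monoid_add"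
  assumes "finite J" "j \<notin> J"
  shows "(\<Sum>A\<in>Pow (insert j J). g A) = (\<Sum>A\<in>Pow J. g A + g (insert j A))"
proof -
  have inj: "inj_on (insert j) (Pow J)"
    using assms by (auto simp: inj_on_def)
  have "(\<Sum>A\<in>Pow (insert j J). g A) = sum g (Pow J) + sum g (insert j ` Pow J)"
    unfolding Pow_insert using assms by (intro sum.union_disjoint) auto
  also have "\<dots> = (\<Sum>A\<in>Pow J. g A + g (insert j A))"
    by (simp add: sum.reindex[OF inj] sum.distrib)
  finally show ?thesis .
qed

lemma zeta_split:
  fixes c :: "nat set \<Rightarrow> 'a::real_normed_field"
  assumes "finite J" "j \<notin> J"
  shows "(\<Sum>A\<in>Pow (insert j J). c A * of_real (zeta \<mu> A x)) =
    (\<Sum>A\<in>Pow J. (c A + c (insert j A) * of_real (zeta1 \<mu> j x)) * of_real (zeta \<mu> A x))"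
  unfolding sum_Pow_insert_split[OF assms]
proof (rule sum.cong[OF refl])
  fix A assume "A \<in> Pow J"
  then have "finite A" "j \<notin> A" using assms by (auto intro: finite_subset)
  then show "c A * of_real (zeta \<mu> A x) + c (insert j A) * of_real (zeta \<mu> (insert j A) x) =
    (c A + c (insert j A) * of_real (zeta1 \<mu> j x)) * of_real (zeta \<mu> A x)"
    by (simp add: zeta_insert algebra_simps)
qed

lemma zeta_indep_Pow:
  fixes c :: "nat set \<Rightarrow> 'a::real_normed_field"
  assumes "\<And>j. \<mu> j > 0" "finite J"
    and "\<And>x. (\<Sum>A\<in>Pow J. c A * of_real (zeta \<mu> A x)) = 0" and "A \<subseteq> J"
  shows "c A = 0"
  using assms(2-4)
proof (induction J arbitrary: c A rule: finite_induct)
  case empty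
  then show ?case by (simp add: zeta_def)
next
  case (insert j J)
  have val: "c B + c (insert j B) * of_real (zeta1 \<mu> j (x0(j := b))) = 0"
    if "B \<subseteq> J" for B b x0
  proof (rule insert.IH[OF _ that])
    fix x
    have z: "zeta1 \<mu> j (x0(j := b)) = zeta1 \<mu> j (x(j := b))"
      by (simp add: zeta1_def)
    have "0 = (\<Sum>A\<in>Pow (insert j J). c A * of_real (zeta \<mu> A (x(j := b))))"
      using insert.prems(1) by simp
    also have "\<dots> = (\<Sum>A\<in>Pow J. (c A + c (insert j A) * of_real (zeta1 \<mu> j (x0(j := b))))
        * of_real (zeta \<mu> A x))"
      unfolding zeta_split[OF insert.hyps] z
      using insert.hyps by (intro sum.cong refl) (subst zeta_upd, auto)
    finally show "(\<Sum>A\<in>Pow J. (c A + c (insert j A) * of_real (zeta1 \<mu> j (x0(j := b))))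
        * of_real (zeta \<mu> A x)) = 0" by simp
  qed
  have both: "c B = 0 \<and> c (insert j B) = 0" if "B \<subseteq> J" for B
  proof -
    define s where "s = (of_real ((\<mu> j)\<^sup>2) :: 'a)"
    define t where "t = (of_real (- inverse ((\<mu> j)\<^sup>2)) :: 'a)"
    have 1: "c B + c (insert j B) * s = 0"
      using val[OF that, of undefined True] unfolding s_def zeta1_upd .
    have 2: "c B + c (insert j B) * t = 0"
      using val[OF that, of undefined False] unfolding t_def zeta1_upd .
    have pos: "(\<mu> j)\<^sup>2 > 0" using assms(1)[of j] by simp
    then have "(\<mu> j)\<^sup>2 \<noteq> - inverse ((\<mu> j)\<^sup>2)"
      by (smt (verit) inverse_positive_iff_positive)
    then have "s \<noteq> t" unfolding s_def t_def of_real_eq_iff .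
    moreover have "c (insert j B) * (s - t) = (c B + c (insert j B) * s) - (c B + c (insert j B) * t)"
      by (simp add: right_diff_distrib)
    then have "c (insert j B) * (s - t) = 0" unfolding 1 2 by simp
    ultimately have "c (insert j B) = 0" by simp
    with 1 show ?thesis by simp
  qed
  show ?case
  proof (cases "j \<in> A")
    case True
    then have "A = insert j (A - {j})" "A - {j} \<subseteq> J" using insert.prems by auto
    with both show ?thesis by metis
  next
    case False
    with insert.prems have "A \<subseteq> J" by auto
    with both show ?thesis by blast
  qed
qed

lemma zeta_span_Pow:
  fixes f :: "(nat \<Rightarrow> bool) \<Rightarrow> 'a::real_normed_field"
  assumes "\<And>j. \<mu> j > 0" "finite J" "depends_on f J"
  shows "\<exists>c. \<forall>x. f x = (\<Sum>A\<in>Pow J. c A * of_real (zeta \<mu> A x))"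
  using assms(2,3)
proof (induction J arbitrary: f rule: finite_induct)
  case empty
  then have "f x = f undefined" for x
    unfolding depends_on_def by blast
  then show ?case by (intro exI[of _ "\<lambda>_. f undefined"]) (simp add: zeta_def)
next
  case (insert j J)
  define s where "s = (of_real ((\<mu> j)\<^sup>2) :: 'a)"
  define t where "t = (of_real (- inverse ((\<mu> j)\<^sup>2)) :: 'a)"
  have pos: "(\<mu> j)\<^sup>2 > 0" using assms(1)[of j] by simp
  then have "(\<mu> j)\<^sup>2 \<noteq> - inverse ((\<mu> j)\<^sup>2)"
    by (smt (verit) inverse_positive_iff_positive)
  then have st: "s \<noteq> t" unfolding s_def t_def of_real_eq_iff .
  define v where "v x = (f (x(j := True)) - f (x(j := False))) / (s - t)" for x
  define u where "u x = f (x(j := True)) - v x * s" for x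
  have dep: "f (x(j := b)) = f (x'(j := b))" if "\<forall>i\<in>J. x i = x' i" for x x' b
    using insert.prems that unfolding depends_on_def by (auto simp: fun_upd_def)
  have eq: "v x = v x'" if "\<forall>i\<in>J. x i = x' i" for x x'
    unfolding v_def dep[OF that] ..
  then have dv: "depends_on v J" unfolding depends_on_def by blast
  have "u x = u x'" if "\<forall>i\<in>J. x i = x' i" for x x'
    unfolding u_def dep[OF that] eq[OF that] ..
  then have du: "depends_on u J" unfolding depends_on_def by blast
  from insert.IH[OF du] obtain a
    where a: "\<And>x. u x = (\<Sum>A\<in>Pow J. a A * of_real (zeta \<mu> A x))" by auto
  from insert.IH[OF dv] obtain b
    where b: "\<And>x. v x = (\<Sum>A\<in>Pow J. b A * of_real (zeta \<mu> A x))" by auto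
  define c where "c A = (if j \<in> A then b (A - {j}) else a A)" for A
  have "f x = (\<Sum>A\<in>Pow (insert j J). c A * of_real (zeta \<mu> A x))" for x
  proof -
    have "f x = u x + v x * of_real (zeta1 \<mu> j x)"
    proof (cases "x j")
      case True
      then have "x(j := True) = x" by (intro ext) simp
      with True show ?thesis by (simp add: u_def zeta1_def s_def)
    next
      case False
      then have w: "x(j := False) = x" by (intro ext) simp
      have "of_real (zeta1 \<mu> j x) = t" using False by (simp add: zeta1_def t_def)
      moreover have "v x * (s - t) = f (x(j := True)) - f x"
        using st by (simp add: v_def w)
      ultimately show ?thesis by (simp add: u_def algebra_simps)
    qed
    also have "\<dots> = (\<Sum>A\<in>Pow J. (a A + b A * of_real (zeta1 \<mu> j x)) * of_real (zeta \<mu> A x))"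
      unfolding a b by (simp add: sum_distrib_right sum_distrib_left sum.distrib algebra_simps)
    also have "\<dots> = (\<Sum>A\<in>Pow (insert j J). c A * of_real (zeta \<mu> A x))"
      unfolding zeta_split[OF insert.hyps]
    proof (rule sum.cong[OF refl])
      fix A assume "A \<in> Pow J"
      then have "j \<notin> A" using insert.hyps by auto
      then show "(a A + b A * of_real (zeta1 \<mu> j x)) * of_real (zeta \<mu> A x) =
        (c A + c (insert j A) * of_real (zeta1 \<mu> j x)) * of_real (zeta \<mu> A x)"
        by (simp add: c_def)
    qed
    finally show ?thesis .
  qed
  then show ?case by blast
qed

lemma zeta_expansion_exists:
  fixes f :: "(nat \<Rightarrow> bool) \<Rightarrow> 'a::real_normed_field"
  assumes "\<And>j. \<mu> j > 0" "finite J" "depends_on f J"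
  shows "\<exists>c. is_zeta_expansion \<mu> f c \<and> (\<forall>A. c A \<noteq> 0 \<longrightarrow> A \<subseteq> J)"
proof -
  obtain c where c: "\<And>x. f x = (\<Sum>A\<in>Pow J. c A * of_real (zeta \<mu> A x))"
    using zeta_span_Pow[of \<mu> J f] assms by blast
  define d where "d A = (if A \<subseteq> J then c A else 0)" for A
  have sub: "{A. d A \<noteq> 0} \<subseteq> Pow J" by (auto simp: d_def)
  have fin: "finite (Pow J)" using assms by simp
  have "f x = (\<Sum>A | d A \<noteq> 0. d A * of_real (zeta \<mu> A x))" for x
  proof -
    have "f x = (\<Sum>A\<in>Pow J. d A * of_real (zeta \<mu> A x))"
      unfolding c by (intro sum.cong) (auto simp: d_def)
    also have "\<dots> = (\<Sum>A | d A \<noteq> 0. d A * of_real (zeta \<mu> A x))"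
      using sub fin by (intro sum.mono_neutral_right) auto
    finally show ?thesis .
  qed
  moreover have "finite {A. d A \<noteq> 0}" using sub fin by (rule finite_subset)
  moreover have dJ: "A \<subseteq> J" if "d A \<noteq> 0" for A
    using that unfolding d_def by presburger
  moreover have "finite A" if "d A \<noteq> 0" for A using dJ[OF that] assms(2) by (rule finite_subset)
  ultimately show ?thesis
    unfolding is_zeta_expansion_def by (intro exI[of _ d] conjI allI impI)
qed

lemma zeta_expansion_unique:
  fixes f :: "(nat \<Rightarrow> bool) \<Rightarrow> 'a::real_normed_field"
  assumes "\<And>j. \<mu> j > 0" "is_zeta_expansion \<mu> f c" "is_zeta_expansion \<mu> f d"
  shows "c = d"
proof
  fix A
  define J where "J = \<Union>({A. c A \<noteq> 0} \<union> {A. d A \<noteq> 0})"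
  have fin: "finite J"
    using assms(2,3) unfolding J_def is_zeta_expansion_def by (intro finite_Union) auto
  have ex: "f x = (\<Sum>A\<in>Pow J. e A * of_real (zeta \<mu> A x))" if "e = c \<or> e = d" for e x
  proof -
    have "f x = (\<Sum>A | e A \<noteq> 0. e A * of_real (zeta \<mu> A x))"
      using assms(2,3) that unfolding is_zeta_expansion_def by blast
    also have "\<dots> = (\<Sum>A\<in>Pow J. e A * of_real (zeta \<mu> A x))"
      using fin that by (intro sum.mono_neutral_left) (auto simp: J_def)
    finally show ?thesis .
  qed
  show "c A = d A"
  proof (cases "A \<subseteq> J")
    case True
    have z: "(\<Sum>A\<in>Pow J. (c A - d A) * of_real (zeta \<mu> A x)) = 0" for x
      using ex[of c x] ex[of d x] by (simp add: left_diff_distrib sum_subtractf)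
    show ?thesis
      using zeta_indep_Pow[of \<mu> J "\<lambda>A. c A - d A", OF assms(1) fin z True] by simp
  next
    case False
    then have "c A = 0" "d A = 0" unfolding J_def by blast+
    then show ?thesis by simp
  qed
qed

lemma zeta_coeff_eq:
  assumes "\<And>j. \<mu> j > 0" "is_zeta_expansion \<mu> f c"
  shows "zeta_coeff \<mu> f = c"
  unfolding zeta_coeff_def using assms zeta_expansion_unique by (intro the_equality) blast+

lemma zeta_linear_eq:
  fixes c :: "nat set \<Rightarrow> 'a::real_normed_field"
  assumes "\<And>j. \<mu> j > 0" "finite S" "\<And>A. A \<in> S \<Longrightarrow> finite A"
    and "\<And>x. f x = (\<Sum>A\<in>S. c A * of_real (zeta \<mu> A x))"
  shows "zeta_linear \<mu> T f x = (\<Sum>A\<in>S. c A * of_real (T A x))"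
proof -
  define d where "d A = (if A \<in> S then c A else 0)" for A
  have sub: "{A. d A \<noteq> 0} \<subseteq> S" by (auto simp: d_def)
  have sums: "(\<Sum>A\<in>S. c A * g A) = (\<Sum>A | d A \<noteq> 0. d A * g A)" for g
  proof -
    have "(\<Sum>A\<in>S. c A * g A) = (\<Sum>A\<in>S. d A * g A)"
      by (intro sum.cong) (auto simp: d_def)
    also have "\<dots> = (\<Sum>A | d A \<noteq> 0. d A * g A)"
      using sub assms(2) by (intro sum.mono_neutral_right) auto
    finally show ?thesis .
  qed
  have "is_zeta_expansion \<mu> f d"
    unfolding is_zeta_expansion_def assms(4) sums
    using sub assms(2,3) finite_subset by (auto simp: d_def)
  then have "zeta_coeff \<mu> f = d" using zeta_coeff_eq assms(1) by blast
  then show ?thesis unfolding zeta_linear_def sums by simp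
qed

lemma D_op_zeta:
  assumes "\<And>j. \<mu> j > 0" "finite A"
  shows "D_op \<mu> j (\<lambda>x. of_real (zeta \<mu> A x)) =
    (\<lambda>x. if j \<in> A then of_real (zeta \<mu> (A - {j}) x) else 0)"
proof
  fix x
  show "D_op \<mu> j (\<lambda>x. of_real (zeta \<mu> A x)) x = (if j \<in> A then of_real (zeta \<mu> (A - {j}) x) else 0)"
    unfolding D_op_def
    by (subst zeta_linear_eq[OF assms(1), where S = "{A}" and c = "\<lambda>_. 1"]) (use assms(2) in auto)
qed

lemma N_inv_sqrt_zeta:
  assumes "\<And>j. \<mu> j > 0" "finite A"
  shows "N_inv_sqrt \<mu> (\<lambda>x. of_real (zeta \<mu> A x)) =
    (\<lambda>x. of_real (real (card A) powr (-1/2)) * of_real (zeta \<mu> A x))"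
proof
  fix x
  show "N_inv_sqrt \<mu> (\<lambda>x. of_real (zeta \<mu> A x)) x = (of_real (real (card A) powr (-1/2)) * of_real (zeta \<mu> A x))"
    unfolding N_inv_sqrt_def
    by (subst zeta_linear_eq[OF assms(1), where S = "{A}" and c = "\<lambda>_. 1"]) (use assms(2) in auto)
qed

lemma zeta_linear_add:
  fixes f g :: "(nat \<Rightarrow> bool) \<Rightarrow> 'a::real_normed_field"
  assumes mu: "\<And>j. \<mu> j > 0" and "depends_on_finitely_many f" "depends_on_finitely_many g"
  shows "zeta_linear \<mu> T (\<lambda>x. a * f x + b * g x) x =
    a * zeta_linear \<mu> T f x + b * zeta_linear \<mu> T g x"
proof -
  obtain K L where KL: "finite K" "depends_on f K" "finite L" "depends_on g L"
    using assms(2,3) unfolding depends_on_finitely_many_def by blast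
  define J where "J = K \<union> L"
  have J: "finite J" "depends_on f J" "depends_on g J"
    using KL unfolding depends_on_def J_def by auto
  from zeta_span_Pow[where \<mu> = \<mu>, OF mu J(1,2)] obtain c where
    c: "\<And>x. f x = (\<Sum>A\<in>Pow J. c A * of_real (zeta \<mu> A x))" by blast
  from zeta_span_Pow[where \<mu> = \<mu>, OF mu J(1,3)] obtain d where
    d: "\<And>x. g x = (\<Sum>A\<in>Pow J. d A * of_real (zeta \<mu> A x))" by blast
  have fin: "finite (Pow J)" "\<And>A. A \<in> Pow J \<Longrightarrow> finite A"
    using J(1) by (auto intro: finite_subset)
  have cd: "a * f x + b * g x = (\<Sum>A\<in>Pow J. (a * c A + b * d A) * of_real (zeta \<mu> A x))" for x
    unfolding c d by (simp add: sum_distrib_left sum.distrib algebra_simps)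
  have 1: "zeta_linear \<mu> T f x = (\<Sum>A\<in>Pow J. c A * of_real (T A x))"
    by (rule zeta_linear_eq[OF mu fin c])
  have 2: "zeta_linear \<mu> T g x = (\<Sum>A\<in>Pow J. d A * of_real (T A x))"
    by (rule zeta_linear_eq[OF mu fin d])
  have "zeta_linear \<mu> T (\<lambda>x. a * f x + b * g x) x =
    (\<Sum>A\<in>Pow J. (a * c A + b * d A) * of_real (T A x))"
    by (rule zeta_linear_eq[OF mu fin cd])
  then show ?thesis
    unfolding 1 2 by (simp add: sum_distrib_left sum.distrib algebra_simps)
qed

lemma prob_space_nu_inf: "prob_space (nu_inf \<mu>)"
  unfolding nu_inf_def nu_def by (intro prob_space_PiM prob_space_measure_pmf)

lemma zeta_measurable: "zeta \<mu> A \<in> borel_measurable (nu_inf \<mu>)"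
proof -
  have "zeta1 \<mu> j \<in> borel_measurable (nu_inf \<mu>)" for j
  proof -
    have c: "(\<lambda>x. x j) \<in> nu_inf \<mu> \<rightarrow>\<^sub>M nu \<mu> j"
      unfolding nu_inf_def by (rule measurable_component_singleton) simp
    have h: "(\<lambda>b. if b then (\<mu> j)\<^sup>2 else - inverse ((\<mu> j)\<^sup>2)) \<in> borel_measurable (nu \<mu> j)"
      unfolding nu_def by simp
    show ?thesis
      using measurable_compose[OF c h] by (simp add: zeta1_def[abs_def])
  qed
  then show ?thesis unfolding zeta_def[abs_def] by (intro borel_measurable_prod)
qed

lemma integrable_finitely_many:
  fixes f :: "(nat \<Rightarrow> bool) \<Rightarrow> 'a::{real_normed_field, banach, second_countable_topology}"
  assumes mu: "\<And>j. \<mu> j > 0" and "depends_on_finitely_many f"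
  shows "integrable (nu_inf \<mu>) f"
proof -
  interpret prob_space "nu_inf \<mu>" by (rule prob_space_nu_inf)
  obtain J where J: "finite J" "depends_on f J"
    using assms(2) unfolding depends_on_finitely_many_def by blast
  from zeta_span_Pow[where \<mu> = \<mu>, OF mu J] obtain c where
    c: "\<And>x. f x = (\<Sum>A\<in>Pow J. c A * of_real (zeta \<mu> A x))" by blast
  have z: "integrable (nu_inf \<mu>) (zeta \<mu> A)" if "finite A" for A
  proof (rule integrable_const_bound[where B = "\<Prod>j\<in>A. (\<mu> j)\<^sup>2 + inverse ((\<mu> j)\<^sup>2)"])
    show "zeta \<mu> A \<in> borel_measurable (nu_inf \<mu>)" by (rule zeta_measurable)
    have "norm (zeta \<mu> A x) \<le> (\<Prod>j\<in>A. (\<mu> j)\<^sup>2 + inverse ((\<mu> j)\<^sup>2))" for x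
      unfolding zeta_def real_norm_def abs_prod zeta1_def by (intro prod_mono) auto
    then show "AE x in nu_inf \<mu>. norm (zeta \<mu> A x) \<le> (\<Prod>j\<in>A. (\<mu> j)\<^sup>2 + inverse ((\<mu> j)\<^sup>2))"
      by simp
  qed
  have "integrable (nu_inf \<mu>) (\<lambda>x. \<Sum>A\<in>Pow J. c A * of_real (zeta \<mu> A x))"
    using J(1) by (intro Bochner_Integration.integrable_sum integrable_mult_right integrable_of_real z)
      (auto intro: finite_subset)
  moreover have "f = (\<lambda>x. \<Sum>A\<in>Pow J. c A * of_real (zeta \<mu> A x))"
    by (rule ext) (rule c)
  ultimately show ?thesis by simp
qed

lemma R_op_eq_0:
  fixes f :: "(nat \<Rightarrow> bool) \<Rightarrow> 'a::real_normed_field"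
  assumes mu: "\<And>j. \<mu> j > 0" and J: "finite J" "depends_on f J" and "j \<notin> J"
  shows "R_op \<mu> j f x = 0"
proof -
  have fin: "finite (Pow J)" "\<And>A. A \<in> Pow J \<Longrightarrow> finite A"
    using J(1) by (auto intro: finite_subset)
  from zeta_span_Pow[where \<mu> = \<mu>, OF mu J] obtain c where
    c: "\<And>x. f x = (\<Sum>A\<in>Pow J. c A * of_real (zeta \<mu> A x))" by blast
  have N: "N_inv_sqrt \<mu> f x =
      (\<Sum>A\<in>Pow J. (c A * of_real (real (card A) powr (-1/2))) * of_real (zeta \<mu> A x))" for x
  proof -
    have "N_inv_sqrt \<mu> f x =
        (\<Sum>A\<in>Pow J. c A * of_real (real (card A) powr (-1/2) * zeta \<mu> A x))"
      unfolding N_inv_sqrt_def by (rule zeta_linear_eq[OF mu fin c])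
    then show ?thesis by (simp add: mult.assoc)
  qed
  have "D_op \<mu> j (N_inv_sqrt \<mu> f) x = (\<Sum>A\<in>Pow J. (c A * of_real (real (card A) powr (-1/2))) *
      of_real (if j \<in> A then zeta \<mu> (A - {j}) x else 0))"
    unfolding D_op_def by (rule zeta_linear_eq[OF mu fin N])
  also have "\<dots> = 0"
    using \<open>j \<notin> J\<close> by (intro sum.neutral) auto
  finally show ?thesis unfolding R_op_def by simp
qed

end

theory Submission
  imports Defs
begin

text \<open>
  Testing the assumed inequality on the single functions \<open>\<zeta>\<^sub>j\<close> is already enough. Put
  \<open>m = max \<mu>\<^sub>j (1/\<mu>\<^sub>j)\<close>. The vector of all \<open>R\<^sub>k \<zeta>\<^sub>j\<close> has the single nonzero entry
  \<open>(\<mu>\<^sub>j\<^sup>-\<^sup>2 + \<mu>\<^sub>j\<^sup>2)/2\<close>, a constant, so the left-hand side is at least \<open>m\<^sup>2/2\<close>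
  (\<open>square_fun_zeta_singleton\<close>).

  On the right-hand side \<open>\<zeta>\<^sub>j\<close> is bounded by \<open>m\<^sup>2\<close> but has second moment \<open>1\<close>, because the
  large value is taken with small probability. Since \<open>p \<ge> 2\<close>, interpolating between these two
  facts bounds the \<open>p\<close>-th moment by \<open>(m\<^sup>2)\<^bsup>p-2\<^esup>\<close> (\<open>pth_moment_zeta_singleton\<close>), which falls
  short of the trivial bound \<open>(m\<^sup>2)\<^bsup>p\<^esup>\<close> by the factor \<open>m\<^sup>4\<close>. Hence
  \<open>(m\<^sup>2/2)\<^bsup>p\<^esup> \<le> C\<^bsup>p\<^esup> (m\<^sup>2)\<^bsup>p-2\<^esup>\<close>, that is, \<open>m\<^sup>4 \<le> (2C)\<^bsup>p\<^esup>\<close>, a bound that does not depend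
  on \<open>j\<close>.
\<close>

lemma integral_nu_inf_coordinate:
  fixes g :: "bool \<Rightarrow> real"
  assumes mu: "\<And>j. \<mu> j > 0"
  shows "(\<integral>x. g (x j) \<partial>nu_inf \<mu>) =
    (inverse ((\<mu> j)\<^sup>2) * g True + (\<mu> j)\<^sup>2 * g False) / (inverse ((\<mu> j)\<^sup>2) + (\<mu> j)\<^sup>2)"
proof -
  define a where "a = (\<mu> j)\<^sup>2"
  have a: "a > 0" using mu[of j] by (simp add: a_def)
  define q where "q = inverse a / (inverse a + a)"
  have ia: "inverse a > 0" using a by simp
  have s: "inverse a + a > 0" using a ia by (rule add_pos_pos[rotated])
  have q: "0 \<le> q" "q \<le> 1"
    using a ia s by (simp_all add: q_def divide_le_eq_1)
  have q': "1 - q = a / (inverse a + a)"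
    using s by (simp add: q_def diff_divide_eq_iff)
  have nu: "nu \<mu> j = measure_pmf (bernoulli_pmf q)"
    by (simp add: nu_def q_def a_def)
  have marginal: "distr (nu_inf \<mu>) (nu \<mu> j) (\<lambda>x. x j) = nu \<mu> j"
    unfolding nu_inf_def
    by (rule distr_PiM_component) (auto simp: nu_def prob_space_measure_pmf)
  have meas: "(\<lambda>x. x j) \<in> nu_inf \<mu> \<rightarrow>\<^sub>M nu \<mu> j"
    unfolding nu_inf_def by (rule measurable_component_singleton) simp
  have "(\<integral>x. g (x j) \<partial>nu_inf \<mu>) = (\<integral>b. g b \<partial>distr (nu_inf \<mu>) (nu \<mu> j) (\<lambda>x. x j))"
    using meas by (intro integral_distr[symmetric]) (auto simp: nu)
  also have "\<dots> = (\<integral>b. g b \<partial>measure_pmf (bernoulli_pmf q))"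
    unfolding marginal unfolding nu ..
  also have "\<dots> = q * g True + (1 - q) * g False"
    using q by simp
  also have "\<dots> = (inverse a * g True + a * g False) / (inverse a + a)"
    by (simp add: q' add_divide_distrib) (simp add: q_def)
  finally show ?thesis by (simp add: a_def)
qed

lemma zeta_singleton: "zeta \<mu> {j} x = zeta1 \<mu> j x"
  by (simp add: zeta_def)

lemma depends_on_zeta: "depends_on (\<lambda>x. of_real (zeta \<mu> A x)) A"
  unfolding depends_on_def zeta_def zeta1_def by (auto intro!: prod.cong arg_cong[of _ _ of_real])

lemma depends_on_finitely_many_zeta:
  "finite A \<Longrightarrow> depends_on_finitely_many (\<lambda>x. of_real (zeta \<mu> A x))"
  unfolding depends_on_finitely_many_def using depends_on_zeta by blast

lemma mean_zero_zeta_singleton: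
  assumes "\<And>j. \<mu> j > 0"
  shows "mean_zero \<mu> (\<lambda>x. of_real (zeta \<mu> {j} x) ::
    'a::{real_normed_field, banach, second_countable_topology})"
proof -
  have "(\<integral>x. zeta \<mu> {j} x \<partial>nu_inf \<mu>) = 0"
    unfolding zeta_singleton zeta1_def
    using integral_nu_inf_coordinate[OF assms, where j = j and
        g = "\<lambda>b. if b then (\<mu> j)\<^sup>2 else - inverse ((\<mu> j)\<^sup>2)"]
    by simp
  moreover have "integrable (nu_inf \<mu>) (zeta \<mu> {j})"
    using integrable_finitely_many[OF assms depends_on_finitely_many_zeta[of "{j}" \<mu>],
        where ?'a = real]
    by simp
  ultimately show ?thesis
    by (simp add: mean_zero_def)
qed

text \<open>The constant \<open>(\<mu>\<^sub>j\<^sup>-\<^sup>2 + \<mu>\<^sub>j\<^sup>2)/2\<close> survives undamped because \<open>\<zeta>\<^sub>j\<close> has degree \<open>1\<close>, where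
  \<open>N\<^bsup>-1/2\<^esup>\<close> acts as the identity.\<close>

lemma R_op_zeta_singleton:
  assumes mu: "\<And>j. \<mu> j > 0"
  shows "R_op \<mu> k (\<lambda>x. of_real (zeta \<mu> {j} x) :: 'a::real_normed_field) x =
    (if k = j then of_real ((inverse ((\<mu> j)\<^sup>2) + (\<mu> j)\<^sup>2) / 2) else 0)"
proof (cases "k = j")
  case True
  have "N_inv_sqrt \<mu> (\<lambda>x. of_real (zeta \<mu> {j} x) :: 'a) = (\<lambda>x. of_real (zeta \<mu> {j} x))"
    using N_inv_sqrt_zeta[OF mu, where A = "{j}" and ?'a = 'a] by simp
  moreover have "D_op \<mu> j (\<lambda>x. of_real (zeta \<mu> {j} x) :: 'a) = (\<lambda>x. 1)"
    using D_op_zeta[OF mu, where A = "{j}" and j = j and ?'a = 'a] by (simp add: zeta_def)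
  ultimately show ?thesis
    unfolding R_op_def True by simp
next
  case False
  then show ?thesis
    using R_op_eq_0[OF mu _ depends_on_zeta[of \<mu> "{j}"], where j = k] by simp
qed

lemma square_fun_zeta_singleton:
  assumes mu: "\<And>j. \<mu> j > 0"
  shows "square_fun \<mu> (\<lambda>x. of_real (zeta \<mu> {j} x) :: 'a::real_normed_field) x =
    (inverse ((\<mu> j)\<^sup>2) + (\<mu> j)\<^sup>2) / 2"
proof -
  have "(\<Sum>k. (norm (R_op \<mu> k (\<lambda>x. of_real (zeta \<mu> {j} x) :: 'a) x))\<^sup>2) =
    (norm (R_op \<mu> j (\<lambda>x. of_real (zeta \<mu> {j} x) :: 'a) x))\<^sup>2"
    by (subst suminf_finite[of "{j}"]) (auto simp: R_op_zeta_singleton[OF mu])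
  also have "\<dots> = ((inverse ((\<mu> j)\<^sup>2) + (\<mu> j)\<^sup>2) / 2)\<^sup>2"
    by (simp add: R_op_zeta_singleton[OF mu] norm_of_real del: of_real_add of_real_divide)
  finally show ?thesis
    unfolding square_fun_def by simp
qed

lemma abs_zeta1_le: "\<bar>zeta1 \<mu> j x\<bar> \<le> (max (\<mu> j) (inverse (\<mu> j)))\<^sup>2" if "\<mu> j > 0"
  using that by (auto simp: zeta1_def simp flip: power_inverse intro!: power_mono)

text \<open>\<open>|\<zeta>\<^sub>j|\<^sup>p \<le> (sup |\<zeta>\<^sub>j|)\<^bsup>p-2\<^esup> |\<zeta>\<^sub>j|\<^sup>2\<close> holds pointwise for \<open>p \<ge> 2\<close>, and \<open>\<zeta>\<^sub>j\<close> is normalised in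
  \<open>L\<^sub>2\<close>.\<close>

lemma pth_moment_zeta_singleton:
  assumes mu: "\<And>j. \<mu> j > 0" and p: "2 \<le> p"
  shows "(\<integral>x. \<bar>zeta \<mu> {j} x\<bar> powr p \<partial>nu_inf \<mu>) \<le> ((max (\<mu> j) (inverse (\<mu> j)))\<^sup>2) powr (p - 2)"
proof -
  define b where "b = (max (\<mu> j) (inverse (\<mu> j)))\<^sup>2"
  define a where "a = (\<mu> j)\<^sup>2"
  have a: "a > 0" using mu[of j] by (simp add: a_def)
  have dep: "depends_on_finitely_many (\<lambda>x. g (zeta \<mu> {j} x) :: real)" for g :: "real \<Rightarrow> real"
    unfolding depends_on_finitely_many_def
    by (rule exI[of _ "{j}"]) (simp add: depends_on_def zeta_singleton zeta1_def)
  have int: "integrable (nu_inf \<mu>) (\<lambda>x. g (zeta \<mu> {j} x))" for g :: "real \<Rightarrow> real"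
    by (rule integrable_finitely_many[OF mu dep])
  have ptw: "\<bar>zeta \<mu> {j} x\<bar> powr p \<le> b powr (p - 2) * (zeta \<mu> {j} x)\<^sup>2" for x
  proof -
    define z where "z = \<bar>zeta \<mu> {j} x\<bar>"
    have z: "0 < z" "z \<le> b"
      using mu[of j] abs_zeta1_le[of \<mu> j x]
      by (auto simp: z_def b_def zeta_singleton zeta1_def)
    have "z powr p = z powr (p - 2) * z powr 2"
      by (simp flip: powr_add)
    also have "\<dots> = z powr (p - 2) * z\<^sup>2"
      using z by simp
    also have "\<dots> \<le> b powr (p - 2) * z\<^sup>2"
      using z p by (intro mult_right_mono powr_mono2) auto
    finally show ?thesis by (simp add: z_def)
  qed
  have "(\<integral>x. (zeta \<mu> {j} x)\<^sup>2 \<partial>nu_inf \<mu>) = (inverse a * a\<^sup>2 + a * (inverse a)\<^sup>2) / (inverse a + a)"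
    unfolding zeta_singleton zeta1_def a_def
    using integral_nu_inf_coordinate[OF mu,
        where j = j and
        g = "\<lambda>b. (if b then (\<mu> j)\<^sup>2 else - inverse ((\<mu> j)\<^sup>2))\<^sup>2"]
    by simp
  also have "\<dots> = 1"
    using a by (simp add: power2_eq_square add.commute divide_simps add_pos_pos less_imp_neq[symmetric])
  finally have second_moment: "(\<integral>x. (zeta \<mu> {j} x)\<^sup>2 \<partial>nu_inf \<mu>) = 1" .
  have "(\<integral>x. \<bar>zeta \<mu> {j} x\<bar> powr p \<partial>nu_inf \<mu>) \<le> (\<integral>x. b powr (p - 2) * (zeta \<mu> {j} x)\<^sup>2 \<partial>nu_inf \<mu>)"
    using ptw by (intro integral_mono int[of "\<lambda>t. \<bar>t\<bar> powr p"]
        int[of "\<lambda>t. b powr (p - 2) * t\<^sup>2"])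
  also have "\<dots> = b powr (p - 2)"
    by (simp add: second_moment)
  finally show ?thesis by (simp add: b_def)
qed

theorem proposition5p6:
  fixes p :: real and \<mu> :: "nat \<Rightarrow> real"
  assumes "2 \<le> p" and "\<And>j. 0 < \<mu> j"
    and "\<exists>C>0. \<forall>f :: (nat \<Rightarrow> bool) \<Rightarrow> 'a::{real_normed_field, banach, second_countable_topology}.
           depends_on_finitely_many f \<longrightarrow> mean_zero \<mu> f \<longrightarrow>
           Lp_norm p (nu_inf \<mu>) (square_fun \<mu> f) \<le> C * Lp_norm p (nu_inf \<mu>) f"
  shows "(SUP j. ereal (max (\<mu> j) (inverse (\<mu> j)))) < \<infinity>"
proof -
  note p = assms(1) and mu = assms(2)
  interpret prob_space "nu_inf \<mu>" by (rule prob_space_nu_inf)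
  obtain C where C: "C > 0"
    and bound: "\<And>f :: (nat \<Rightarrow> bool) \<Rightarrow> 'a. depends_on_finitely_many f \<Longrightarrow> mean_zero \<mu> f \<Longrightarrow>
           Lp_norm p (nu_inf \<mu>) (square_fun \<mu> f) \<le> C * Lp_norm p (nu_inf \<mu>) f"
    using assms(3) by blast
  have "max (\<mu> j) (inverse (\<mu> j)) \<le> (2 * C) powr p" for j
  proof -
    define m where "m = max (\<mu> j) (inverse (\<mu> j))"
    define r where "r = (inverse ((\<mu> j)\<^sup>2) + (\<mu> j)\<^sup>2) / 2"
    define f where "f = (\<lambda>x. of_real (zeta \<mu> {j} x) :: 'a)"
    define E where "E = (\<integral>x. \<bar>zeta \<mu> {j} x\<bar> powr p \<partial>nu_inf \<mu>)"
    have m: "m \<ge> 1"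
      using mu[of j] one_le_inverse[of "\<mu> j"] unfolding m_def by linarith
    have r: "m\<^sup>2 \<le> 2 * r"
      using mu[of j] by (auto simp: m_def r_def max_def power_inverse)
    have r0: "0 \<le> r" by (simp add: r_def)
    have E: "0 \<le> E" "E \<le> (m\<^sup>2) powr (p - 2)"
      using pth_moment_zeta_singleton[OF mu p, where j = j] by (simp_all add: E_def m_def)
    have "Lp_norm p (nu_inf \<mu>) (square_fun \<mu> f) = r"
      using p r0 unfolding Lp_norm_def f_def square_fun_zeta_singleton[OF mu] r_def[symmetric]
      by (simp add: prob_space powr_powr)
    moreover have "Lp_norm p (nu_inf \<mu>) f = E powr (1 / p)"
      by (simp add: Lp_norm_def f_def E_def)
    moreover have "depends_on_finitely_many f"
      unfolding f_def by (rule depends_on_finitely_many_zeta) simp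
    ultimately have "r \<le> C * E powr (1 / p)"
      using bound[of f] mean_zero_zeta_singleton[of \<mu> j, OF mu, where ?'a = 'a] by (simp add: f_def)
    then have "m\<^sup>2 \<le> (2 * C) * E powr (1 / p)"
      using r by simp
    then have "(m\<^sup>2) powr p \<le> ((2 * C) * E powr (1 / p)) powr p"
      using p by (intro powr_mono2) auto
    also have "\<dots> = (2 * C) powr p * E"
      using C E p by (simp add: powr_mult powr_powr)
    also have "\<dots> \<le> (2 * C) powr p * (m\<^sup>2) powr (p - 2)"
      using E by (intro mult_left_mono) auto
    finally have "(m\<^sup>2) powr (2 + (p - 2)) \<le> (2 * C) powr p * (m\<^sup>2) powr (p - 2)"
      by simp
    then have "(m\<^sup>2) powr 2 * (m\<^sup>2) powr (p - 2) \<le> (2 * C) powr p * (m\<^sup>2) powr (p - 2)"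
      unfolding powr_add .
    then have "(m\<^sup>2) powr 2 \<le> (2 * C) powr p"
      using m by (simp add: mult_le_cancel_right)
    moreover have "m \<le> m ^ 4"
      using m self_le_power[of m 4] by simp
    moreover have "(m\<^sup>2) powr 2 = m ^ 4"
      using m by simp
    ultimately show ?thesis by (simp add: m_def)
  qed
  then have "(SUP j. ereal (max (\<mu> j) (inverse (\<mu> j)))) \<le> ereal ((2 * C) powr p)"
    by (intro SUP_least) simp
  then show ?thesis
    by (rule order.strict_trans1) simp
qed

end
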